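(* Let $G$ be a graph and $(T,\beta)$ a tree-decomposition of $G$ such that (1) for every node $t\in V(T)$ the torso of $t$ has basis number at most $b$, and (2) there is a family $\mathcal{P}$ of paths of $G$ capturing the adhesions of $(T,\beta)$ with edge-congestion at most $c$. Then $\mathrm{bn}(G)\le(2c+1)(b+1)$.
   Context: All graphs are finite and simple. Basis number: subsets of $E(G)$ form an $\mathbb{F}_2$-vector space under symmetric difference; an $\mathbb{F}_2$-cycle is a subgraph with all degrees even; these form the cycle space, a cycle basis is a basis of it; the congestion of a family of subgraphs is the maximum over edges $e$ of the number of members containing $e$ (counted with multiplicity); $\mathrm{bn}(G)$ is the minimum congestion of a cycle basis. A tree-decomposition $(T,\beta)$ has a rooted tree $T$ and bags $\beta(t)\subseteq V(G)$ such that every vertex lies in a bag, every edge lies within a bag, and bags containing any given vertex form a connected subtree. The adhesion of $t$ is $\beta(t)\cap\beta(\text{parent}(t))$ (empty for the root). The torso of $t$ is $G[\beta(t)]$ with an edge $uv$ added for every pair $u,v$ lying in the adhesion of $t$ or of a child of $t$. A multiset $\mathcal{P}$ of paths captures the adhesions of $(T,\beta)$ if it consists of paths $P_{t,u,v}$, one for each node $t$ and each pair of distinct vertices $u,v$ in the adhesion of $t$, where $P_{t,u,v}$ is any path in $G$ from $u$ to $v$ (different indices may give equal paths). Its congestion is $\max_{e\in E(G)}|\{(t,u,v): e\in P_{t,u,v}\}|$. *)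

theory Defs
  imports Main
begin

datatype 'a graph = Graph (verts: "'a set") (edges: "'a set set")

definition simple_graph :: "'a graph \<Rightarrow> bool" where
  "simple_graph G \<longleftrightarrow> finite (verts G) \<and> (\<forall>e\<in>edges G. e \<subseteq> verts G \<and> card e = 2)"

text \<open>The congestion of an indexed family \<open>(F i)\<close>, \<open>i \<in> I\<close>, of edge sets: members are counted
  by index, hence with multiplicity. It is \<open>0\<close> for an edgeless graph.\<close>

definition congestion :: "'a graph \<Rightarrow> 'i set \<Rightarrow> ('i \<Rightarrow> 'a set set) \<Rightarrow> nat" where
  "congestion G I F = Max (insert 0 ((\<lambda>e. card {i\<in>I. e \<in> F i}) ` edges G))"

text \<open>Subgraphs belonging to the cycle space are identified with their edge sets.\<close>

definition cycle_space :: "'a graph \<Rightarrow> 'a set set set" where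
  "cycle_space G = {F. F \<subseteq> edges G \<and> (\<forall>v\<in>verts G. even (card {e\<in>F. v \<in> e}))}"

text \<open>The sum over the two-element field (iterated symmetric difference) of a finite set of
  edge sets; see the two lemmas below.\<close>

definition f2_sum :: "'e set set \<Rightarrow> 'e set" where
  "f2_sum S = {e. odd (card {C\<in>S. e \<in> C})}"

lemma f2_sum_empty: "f2_sum {} = {}"
  by (simp add: f2_sum_def)

lemma f2_sum_insert:
  assumes "finite S" "C \<notin> S"
  shows "f2_sum (insert C S) = (C - f2_sum S) \<union> (f2_sum S - C)"
proof -
  have "{D \<in> insert C S. e \<in> D} = (if e \<in> C then insert C {D\<in>S. e \<in> D} else {D\<in>S. e \<in> D})" for e
    by auto
  then show ?thesis
    using assms by (auto simp: f2_sum_def)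
qed

definition cycle_basis :: "'a graph \<Rightarrow> 'a set set set \<Rightarrow> bool" where
  "cycle_basis G B \<longleftrightarrow>
     B \<subseteq> cycle_space G \<and>
     (\<forall>S\<subseteq>B. f2_sum S = {} \<longrightarrow> S = {}) \<and>
     (\<forall>F\<in>cycle_space G. \<exists>S\<subseteq>B. F = f2_sum S)"

definition basis_number :: "'a graph \<Rightarrow> nat" where
  "basis_number G = (LEAST k. \<exists>B. cycle_basis G B \<and> k = congestion G B (\<lambda>C. C))"

text \<open>Paths are given by their lists of pairwise distinct vertices.\<close>

definition is_path :: "'a graph \<Rightarrow> 'a \<Rightarrow> 'a \<Rightarrow> 'a list \<Rightarrow> bool" where
  "is_path G u v p \<longleftrightarrow>
     p \<noteq> [] \<and> hd p = u \<and> last p = v \<and> distinct p \<and> set p \<subseteq> verts G \<and>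
     successively (\<lambda>x y. {x, y} \<in> edges G) p"

definition path_edges :: "'a list \<Rightarrow> 'a set set" where
  "path_edges p = {{p ! i, p ! Suc i} | i. Suc i < length p}"

definition induced_subgraph :: "'a graph \<Rightarrow> 'a set \<Rightarrow> 'a graph" where
  "induced_subgraph G X = Graph (verts G \<inter> X) {e\<in>edges G. e \<subseteq> X}"

definition connected_graph :: "'a graph \<Rightarrow> bool" where
  "connected_graph G \<longleftrightarrow>
     verts G \<noteq> {} \<and> (\<forall>u\<in>verts G. \<forall>v\<in>verts G. \<exists>p. is_path G u v p)"

definition acyclic_graph :: "'a graph \<Rightarrow> bool" where
  "acyclic_graph G \<longleftrightarrow>
     (\<nexists>u v p. is_path G u v p \<and> length p \<ge> 3 \<and> {v, u} \<in> edges G)"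

definition rooted_tree :: "'t graph \<Rightarrow> 't \<Rightarrow> bool" where
  "rooted_tree T r \<longleftrightarrow>
     simple_graph T \<and> connected_graph T \<and> acyclic_graph T \<and> r \<in> verts T"

text \<open>The parent of a non-root node \<open>t\<close> is the second vertex on the path from \<open>t\<close> to the root;
  the value at the root is irrelevant and never used.\<close>

definition parent :: "'t graph \<Rightarrow> 't \<Rightarrow> 't \<Rightarrow> 't" where
  "parent T r t = (THE s. \<exists>q. is_path T t r (t # s # q))"

definition children :: "'t graph \<Rightarrow> 't \<Rightarrow> 't \<Rightarrow> 't set" where
  "children T r t = {s\<in>verts T. s \<noteq> r \<and> parent T r s = t}"

definition tree_decomposition :: "'a graph \<Rightarrow> 't graph \<Rightarrow> 't \<Rightarrow> ('t \<Rightarrow> 'a set) \<Rightarrow> bool" where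
  "tree_decomposition G T r \<beta> \<longleftrightarrow>
     rooted_tree T r \<and>
     (\<forall>t\<in>verts T. \<beta> t \<subseteq> verts G) \<and>
     (\<forall>v\<in>verts G. \<exists>t\<in>verts T. v \<in> \<beta> t) \<and>
     (\<forall>e\<in>edges G. \<exists>t\<in>verts T. e \<subseteq> \<beta> t) \<and>
     (\<forall>v\<in>verts G. connected_graph (induced_subgraph T {t\<in>verts T. v \<in> \<beta> t}))"

definition adhesion :: "'t graph \<Rightarrow> 't \<Rightarrow> ('t \<Rightarrow> 'a set) \<Rightarrow> 't \<Rightarrow> 'a set" where
  "adhesion T r \<beta> t = (if t = r then {} else \<beta> t \<inter> \<beta> (parent T r t))"

definition torso :: "'a graph \<Rightarrow> 't graph \<Rightarrow> 't \<Rightarrow> ('t \<Rightarrow> 'a set) \<Rightarrow> 't \<Rightarrow> 'a graph" where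
  "torso G T r \<beta> t =
     Graph (\<beta> t)
       (edges (induced_subgraph G (\<beta> t)) \<union>
        {{u, v} | u v. u \<noteq> v \<and>
           (\<exists>s\<in>insert t (children T r t). u \<in> adhesion T r \<beta> s \<and> v \<in> adhesion T r \<beta> s)})"

text \<open>The pairs of distinct vertices indexing the paths are unordered: one path for each node \<open>t\<close>
  and each two-element subset \<open>{u, v}\<close> of the adhesion of \<open>t\<close>.\<close>

definition adhesion_pairs :: "'t graph \<Rightarrow> 't \<Rightarrow> ('t \<Rightarrow> 'a set) \<Rightarrow> ('t \<times> 'a set) set" where
  "adhesion_pairs T r \<beta> =
     {(t, {u, v}) | t u v. t \<in> verts T \<and> u \<noteq> v \<and> u \<in> adhesion T r \<beta> t \<and> v \<in> adhesion T r \<beta> t}"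

definition captures_adhesions ::
  "'a graph \<Rightarrow> 't graph \<Rightarrow> 't \<Rightarrow> ('t \<Rightarrow> 'a set) \<Rightarrow> ('t \<times> 'a set \<Rightarrow> 'a list) \<Rightarrow> bool" where
  "captures_adhesions G T r \<beta> P \<longleftrightarrow>
     (\<forall>(t, e)\<in>adhesion_pairs T r \<beta>. \<exists>u v. e = {u, v} \<and> is_path G u v (P (t, e)))"

end

theory Submission
  imports Defs
begin

text \<open>
  Over the two-element field, \<^term>\<open>f2_sum\<close> applied to a set of edges is the boundary map, so a cycle
  is an edge set with empty \<^term>\<open>f2_sum\<close>. Every cycle of \<open>G\<close> is a sum of cycles of the torsos. Fix a
  basis of small congestion for each torso. Each torso edge \<open>e\<close> at a node \<open>t\<close> is realised in \<open>G\<close> by a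
  route: the path of \<open>(t, e)\<close> if \<open>e\<close> lies in the adhesion of \<open>t\<close>, otherwise \<open>e\<close> itself if it is an
  edge of \<open>G\<close> (this happens only at the topmost node containing \<open>e\<close>), otherwise the path of \<open>(s, e)\<close>
  for some child \<open>s\<close>. An edge \<open>f\<close> of \<open>G\<close> lies on at most \<open>2 * c + 1\<close> of these routes, so the rerouted
  torso bases contribute at most \<open>(2 * c + 1) * b\<close> to the congestion.

  The same pair may be routed differently at different nodes. To compensate, all routes of a pair
  \<open>e\<close> are arranged in a line, beginning with \<open>e\<close> itself if it is an edge, and the sums of consecutive
  routes are added to the generators. A path occurs in at most two such sums and the trivial route
  in at most one, which contributes at most \<open>2 * c + 1\<close>. Together these cycles span the cycle space.
\<close>

section \<open>Sums over the two-element field\<close>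

text \<open>Members are counted by index, so equal members at different indices cancel, whereas a
  set passed to \<open>f2_sum\<close> would merge them. This matters for sums over nodes, where the
  same star may be added twice.\<close>

definition f2_family_sum :: "'i set \<Rightarrow> ('i \<Rightarrow> 'e set) \<Rightarrow> 'e set" where
  "f2_family_sum I F = {e. odd (card {i\<in>I. e \<in> F i})}"

lemma f2_sum_eq_family_sum: "f2_sum S = f2_family_sum S (\<lambda>C. C)"
  by (simp add: f2_sum_def f2_family_sum_def)

lemma f2_family_sum_empty [simp]: "f2_family_sum {} F = {}"
  by (simp add: f2_family_sum_def)

lemma f2_family_sum_insert:
  assumes "finite I" "i \<notin> I"
  shows "f2_family_sum (insert i I) F = sym_diff (F i) (f2_family_sum I F)"
proof -
  have "{j \<in> insert i I. e \<in> F j} = (if e \<in> F i then insert i {j\<in>I. e \<in> F j} else {j\<in>I. e \<in> F j})"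
    for e
    by auto
  then show ?thesis
    using assms by (auto simp: f2_family_sum_def)
qed

lemma f2_family_sum_cong:
  assumes "\<And>i. i \<in> I \<Longrightarrow> F i = H i"
  shows "f2_family_sum I F = f2_family_sum I H"
proof -
  have "{i\<in>I. e \<in> F i} = {i\<in>I. e \<in> H i}" for e
    using assms by auto
  then show ?thesis
    by (simp add: f2_family_sum_def)
qed

lemma f2_family_sum_subset: "f2_family_sum I F \<subseteq> (\<Union>i\<in>I. F i)"
proof
  fix e assume "e \<in> f2_family_sum I F"
  then have "{i\<in>I. e \<in> F i} \<noteq> {}"
    by (auto simp only: f2_family_sum_def card.empty mem_Collect_eq even_zero)
  then show "e \<in> (\<Union>i\<in>I. F i)" by blast
qed

lemma even_card_sym_diff:
  assumes "finite A" "finite B"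
  shows "even (card (sym_diff A B)) \<longleftrightarrow> (even (card A) \<longleftrightarrow> even (card B))"
proof -
  have "card (sym_diff A B) = card (A - B) + card (B - A)"
    using assms by (intro card_Un_disjoint) auto
  moreover have "card A = card (A - B) + card (A \<inter> B)"
    using assms by (subst card_Un_disjoint [symmetric]) (auto intro!: arg_cong [where f = card])
  moreover have "card B = card (B - A) + card (A \<inter> B)"
    using assms by (subst card_Un_disjoint [symmetric]) (auto intro!: arg_cong [where f = card])
  ultimately show ?thesis by auto
qed

lemma f2_family_sum_sym_diff_index:
  assumes "finite I" "finite J"
  shows "f2_family_sum (sym_diff I J) F = sym_diff (f2_family_sum I F) (f2_family_sum J F)"
proof -
  have "{i \<in> sym_diff I J. e \<in> F i} = sym_diff {i\<in>I. e \<in> F i} {i\<in>J. e \<in> F i}" for e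
    by auto
  then have "odd (card {i \<in> sym_diff I J. e \<in> F i}) \<longleftrightarrow>
      (odd (card {i\<in>I. e \<in> F i}) \<noteq> odd (card {i\<in>J. e \<in> F i}))" for e
    using even_card_sym_diff [of "{i\<in>I. e \<in> F i}" "{i\<in>J. e \<in> F i}"] assms by auto
  then show ?thesis
    unfolding f2_family_sum_def by blast
qed

lemma f2_family_sum_sym_diff:
  assumes "finite I"
  shows "f2_family_sum I (\<lambda>i. sym_diff (F i) (H i))
    = sym_diff (f2_family_sum I F) (f2_family_sum I H)"
  using assms by (induction I rule: finite_induct) (auto simp: f2_family_sum_insert)

text \<open>For fixed \<open>h\<close>, sending a finite set \<open>X\<close> to
  \<open>f2_family_sum X h\<close> is the linear extension of \<open>h\<close>. The identity as
  \<open>h\<close> gives the boundary map, a choice of routes gives the rerouting map.\<close>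

lemma f2_family_sum_linear:
  assumes "finite I" "\<And>i. i \<in> I \<Longrightarrow> finite (F i)"
  shows "f2_family_sum (f2_family_sum I F) h = f2_family_sum I (\<lambda>i. f2_family_sum (F i) h)"
  using assms
proof (induction I rule: finite_induct)
  case empty
  then show ?case by simp
next
  case (insert i I)
  have "finite (f2_family_sum I F)"
    by (rule finite_subset [OF f2_family_sum_subset]) (use insert in auto)
  then show ?case
    using insert by (simp add: f2_family_sum_insert f2_family_sum_sym_diff_index)
qed

lemma f2_family_sum_singletons: "f2_family_sum Z (\<lambda>e. {e}) = Z"
proof -
  have "{i\<in>Z. e \<in> {i}} = (if e \<in> Z then {e} else {})" for e
    by auto
  then show ?thesis by (auto simp: f2_family_sum_def)
qed

lemma f2_sum_family_sum:
  assumes "finite I" "\<And>i. i \<in> I \<Longrightarrow> finite (F i)"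
  shows "f2_sum (f2_family_sum I F) = f2_family_sum I (\<lambda>i. f2_sum (F i))"
  using f2_family_sum_linear [OF assms] by (simp add: f2_sum_eq_family_sum)

lemma f2_sum_sym_diff:
  "finite A \<Longrightarrow> finite B \<Longrightarrow> f2_sum (sym_diff A B) = sym_diff (f2_sum A) (f2_sum B)"
  by (simp add: f2_sum_eq_family_sum f2_family_sum_sym_diff_index)

lemma f2_sum_subset: "f2_sum S \<subseteq> \<Union>S"
  using f2_family_sum_subset [of S "\<lambda>C. C"] by (simp add: f2_sum_eq_family_sum)

section \<open>Spans and independent spanning subsets\<close>

definition f2_span :: "'e set set \<Rightarrow> 'e set set" where
  "f2_span S = f2_sum ` Pow S"

lemma f2_span_empty_mem: "{} \<in> f2_span S"
  unfolding f2_span_def by (rule image_eqI [of _ _ "{}"]) (auto simp: f2_sum_empty)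

lemma f2_span_base: "C \<in> S \<Longrightarrow> C \<in> f2_span S"
  unfolding f2_span_def
  by (rule image_eqI [of _ _ "{C}"]) (auto simp: f2_sum_empty f2_sum_insert)

lemma f2_span_sym_diff:
  assumes "finite S" "A \<in> f2_span S" "B \<in> f2_span S"
  shows "sym_diff A B \<in> f2_span S"
proof -
  obtain X Y where "X \<subseteq> S" "A = f2_sum X" "Y \<subseteq> S" "B = f2_sum Y"
    using assms by (auto simp: f2_span_def)
  then have "sym_diff A B = f2_sum (sym_diff X Y)" "sym_diff X Y \<subseteq> S"
    using assms(1) by (auto simp only: f2_sum_sym_diff finite_subset)
  then show ?thesis
    unfolding f2_span_def by blast
qed

lemma f2_span_family_sum:
  assumes "finite S" "finite I" "\<And>i. i \<in> I \<Longrightarrow> F i \<in> f2_span S"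
  shows "f2_family_sum I F \<in> f2_span S"
  using assms(2,3)
  by (induction I rule: finite_induct)
    (simp_all add: f2_span_empty_mem f2_family_sum_insert f2_span_sym_diff [OF assms(1)])

lemma f2_span_subset_span:
  assumes "finite S" "finite A" "A \<subseteq> f2_span S"
  shows "f2_span A \<subseteq> f2_span S"
proof
  fix X assume "X \<in> f2_span A"
  then obtain A' where "A' \<subseteq> A" "X = f2_sum A'" by (auto simp: f2_span_def)
  then show "X \<in> f2_span S"
    using assms by (auto simp: f2_sum_eq_family_sum intro!: f2_span_family_sum
        intro: finite_subset)
qed

text \<open>A spanning subset of least cardinality works: a dependency \<open>X\<close> would
  express some member \<open>C\<close> as the sum of the others, so that \<open>C\<close> could be
  dropped.\<close>

lemma f2_independent_spanning_subset:
  assumes "finite S"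
  obtains B where "B \<subseteq> S" "\<forall>X\<subseteq>B. f2_sum X = {} \<longrightarrow> X = {}" "f2_span B = f2_span S"
proof -
  let ?P = "\<lambda>B. B \<subseteq> S \<and> f2_span S \<subseteq> f2_span B"
  obtain B where B: "?P B" and min: "\<And>B'. ?P B' \<Longrightarrow> card B \<le> card B'"
    using arg_min_nat_lemma [of ?P S card] by auto
  have fin: "finite B" using B assms finite_subset by blast
  have "X = {}" if X: "X \<subseteq> B" "f2_sum X = {}" for X
  proof (rule ccontr)
    assume "X \<noteq> {}"
    then obtain C where C: "C \<in> X" by auto
    have finX: "finite X" using X fin finite_subset by blast
    have "sym_diff C (f2_sum (X - {C})) = {}"
      using f2_sum_insert [of "X - {C}" C] X finX C by (simp add: insert_absorb)
    then have "C = f2_sum (X - {C})" by blast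
    then have "C \<in> f2_span (B - {C})" using X unfolding f2_span_def by blast
    then have "D \<in> f2_span (B - {C})" if "D \<in> B" for D
      using that f2_span_base [of D "B - {C}"] by (cases "D = C") auto
    then have "f2_span B \<subseteq> f2_span (B - {C})"
      using fin by (intro f2_span_subset_span) auto
    then have "card B \<le> card (B - {C})" using B by (intro min) auto
    moreover have "C \<in> B" using C X by auto
    ultimately show False using fin card_Diff1_less by (metis leD)
  qed
  moreover have "f2_span B \<subseteq> f2_span S"
    unfolding f2_span_def using B by blast
  ultimately show ?thesis using that B by blast
qed

section \<open>Boundaries of sets of pairs: parity and stars\<close>

lemma even_card_f2_sum:
  assumes "finite F" "\<And>e. e \<in> F \<Longrightarrow> card e = 2"
  shows "even (card (f2_sum F))"
  using assms
proof (induction F rule: finite_induct)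
  case empty
  then show ?case by (simp add: f2_sum_empty)
next
  case (insert e F)
  have "finite x" if "x \<in> insert e F" for x
    using insert.prems that by (metis card.infinite zero_neq_numeral)
  then have "finite e" "finite (f2_sum F)"
    using insert.hyps by (auto intro: finite_subset [OF f2_sum_subset])
  then show ?case
    using insert even_card_sym_diff [of e "f2_sum F"] by (simp add: f2_sum_insert)
qed

text \<open>In a star centred at \<open>a\<close> inside \<open>X\<close>, every other vertex of
  \<open>X\<close> lies on one edge and \<open>a\<close> on \<open>card X - 1\<close> edges, an odd
  number. The pairs are arbitrary, since they will serve as virtual edges inside an
  adhesion.\<close>

lemma star_with_boundary:
  assumes "finite X" "even (card X)"
  obtains M where "\<And>e. e \<in> M \<Longrightarrow> card e = 2 \<and> e \<subseteq> X" "finite M" "f2_sum M = X"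
proof (cases "X = {}")
  case True
  then show ?thesis using that [of "{}"] by (simp add: f2_sum_empty)
next
  case False
  then obtain a where a: "a \<in> X" by auto
  let ?M = "(\<lambda>x. {a, x}) ` (X - {a})"
  have inj: "inj_on (\<lambda>x. {a, x}) (X - {a})"
    by (auto simp: inj_on_def doubleton_eq_iff)
  have "v \<in> f2_sum ?M \<longleftrightarrow> v \<in> X" for v
  proof (cases "v = a")
    case True
    then have "{e \<in> ?M. v \<in> e} = ?M" by auto
    then have "card {e \<in> ?M. v \<in> e} = card X - 1"
      using card_image [OF inj] a assms by simp
    moreover have "odd (card X - 1)" using a assms card_gt_0_iff [of X] by auto
    ultimately show ?thesis using True a by (simp add: f2_sum_def)
  next
    case False
    then have "{e \<in> ?M. v \<in> e} = (if v \<in> X then {{a, v}} else {})" by auto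
    then show ?thesis by (simp add: f2_sum_def)
  qed
  then have "f2_sum ?M = X" by blast
  moreover have "card e = 2 \<and> e \<subseteq> X" if "e \<in> ?M" for e
    using that a by auto
  ultimately show ?thesis using that assms by blast
qed

section \<open>Cycle bases, congestion and paths\<close>

lemma finite_edges: "simple_graph G \<Longrightarrow> finite (edges G)"
  unfolding simple_graph_def by (rule finite_subset [of _ "Pow (verts G)"]) auto

text \<open>\<open>f2_sum F\<close> is the set of vertices of odd degree. Edges of a simple graph
  lie inside \<open>verts G\<close>, so the quantifier over \<open>verts G\<close> misses none of
  them.\<close>

lemma cycle_space_iff:
  assumes "simple_graph G"
  shows "F \<in> cycle_space G \<longleftrightarrow> F \<subseteq> edges G \<and> f2_sum F = {}"
proof -
  have "f2_sum F \<subseteq> verts G" if "F \<subseteq> edges G"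
    using assms that f2_sum_subset [of F] unfolding simple_graph_def by blast
  then show ?thesis
    by (auto simp: cycle_space_def f2_sum_def)
qed

lemma card_le_congestion:
  assumes "finite (edges G)" "e \<in> edges G"
  shows "card {i\<in>I. e \<in> F i} \<le> congestion G I F"
  unfolding congestion_def using assms by (intro Max_ge) auto

lemma congestion_le:
  assumes "finite (edges G)" "\<And>e. e \<in> edges G \<Longrightarrow> card {i\<in>I. e \<in> F i} \<le> k"
  shows "congestion G I F \<le> k"
  unfolding congestion_def using assms by (intro Max.boundedI) auto

lemma cycle_basis_within_spanning_set:
  assumes "S \<subseteq> cycle_space G" "finite S" "cycle_space G \<subseteq> f2_span S"
  obtains B where "cycle_basis G B" "B \<subseteq> S"
proof -
  obtain B where B: "B \<subseteq> S" "\<forall>X\<subseteq>B. f2_sum X = {} \<longrightarrow> X = {}" "f2_span B = f2_span S"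
    using f2_independent_spanning_subset assms(2) by blast
  then have "F \<in> f2_sum ` Pow B" if "F \<in> cycle_space G" for F
    using that assms(3) by (auto simp: f2_span_def)
  then have "cycle_basis G B"
    using B assms(1) unfolding cycle_basis_def by blast
  then show ?thesis using that B by blast
qed

lemma basis_number_le:
  assumes "simple_graph G" "S \<subseteq> cycle_space G" "cycle_space G \<subseteq> f2_span S"
    and "\<And>e. e \<in> edges G \<Longrightarrow> card {C\<in>S. e \<in> C} \<le> k"
  shows "basis_number G \<le> k"
proof -
  note fin = finite_edges [OF assms(1)]
  have finS: "finite S"
    using assms(2) fin by (intro finite_subset [of S "Pow (edges G)"]) (auto simp: cycle_space_def)
  obtain B where B: "cycle_basis G B" "B \<subseteq> S"
    using cycle_basis_within_spanning_set [OF assms(2) finS assms(3)] .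
  have "congestion G B (\<lambda>C. C) \<le> k"
  proof (rule congestion_le [OF fin])
    fix e assume "e \<in> edges G"
    have "card {C\<in>B. e \<in> C} \<le> card {C\<in>S. e \<in> C}"
      using B finS by (intro card_mono) auto
    then show "card {C\<in>B. e \<in> C} \<le> k" using assms(4) \<open>e \<in> edges G\<close> by fastforce
  qed
  moreover have "basis_number G \<le> congestion G B (\<lambda>C. C)"
    unfolding basis_number_def using B by (intro Least_le) auto
  ultimately show ?thesis by simp
qed

text \<open>\<open>LEAST\<close> is meaningful only once some basis exists; one is extracted from
  the whole cycle space, which spans itself.\<close>

lemma basis_number_attained:
  assumes "simple_graph G"
  obtains B where "cycle_basis G B" "congestion G B (\<lambda>C. C) = basis_number G"
proof -
  have "finite (cycle_space G)"
    using finite_edges [OF assms]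
    by (intro finite_subset [of "cycle_space G" "Pow (edges G)"]) (auto simp: cycle_space_def)
  then obtain B where "cycle_basis G B"
    using cycle_basis_within_spanning_set [of "cycle_space G" G] f2_span_base
    by (metis subset_iff)
  then have "\<exists>k B. cycle_basis G B \<and> k = congestion G B (\<lambda>C. C)" by blast
  from LeastI_ex [OF this] show ?thesis
    using that unfolding basis_number_def by metis
qed

section \<open>Edge sets of paths and their boundaries\<close>

lemma path_edges_eq_image: "path_edges p = (\<lambda>i. {p ! i, p ! Suc i}) ` {..<length p - 1}"
  by (auto simp: path_edges_def)

lemma path_edges_Cons_Cons: "path_edges (x # y # p) = insert {x, y} (path_edges (y # p))"
  by (simp add: path_edges_eq_image lessThan_Suc_eq_insert_0 image_image)

lemma path_edges_singleton [simp]: "path_edges [x] = {}"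
  by (simp add: path_edges_def)

lemma finite_path_edges: "finite (path_edges p)"
  by (simp add: path_edges_eq_image)

lemma Union_path_edges_subset: "\<Union>(path_edges p) \<subseteq> set p"
  by (auto simp: path_edges_def)

text \<open>Each edge added in front moves one odd vertex to the new head. The symmetric difference
  also covers the one-vertex path, whose boundary is empty.\<close>

lemma f2_sum_path_edges:
  assumes "p \<noteq> []" "distinct p"
  shows "f2_sum (path_edges p) = sym_diff {hd p} {last p}"
  using assms
proof (induction p rule: induct_list012)
  case (3 x y p)
  have "{x, y} \<notin> path_edges (y # p)"
    using Union_path_edges_subset [of "y # p"] 3(4) by auto
  moreover have "last (y # p) \<noteq> x"
    using 3(4) last_in_set [of "y # p"] by (metis distinct.simps(2) list.discI)
  ultimately show ?case
    using 3 by (auto simp: path_edges_Cons_Cons f2_sum_insert finite_path_edges)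
qed (simp_all add: f2_sum_empty)

lemma path_edges_subset:
  assumes "successively (\<lambda>x y. {x, y} \<in> edges G) p"
  shows "path_edges p \<subseteq> edges G"
  using assms
proof (induction p rule: induct_list012)
  case 1
  then show ?case by (simp add: path_edges_def)
qed (simp_all add: path_edges_Cons_Cons)

section \<open>Rooted trees\<close>

lemma is_path_Cons_Cons:
  "is_path G u v (x # y # q) \<longleftrightarrow>
     x = u \<and> x \<in> verts G \<and> x \<notin> set (y # q) \<and> {x, y} \<in> edges G \<and> is_path G y v (y # q)"
  by (auto simp: is_path_def)

text \<open>Two different second vertices would close a cycle: follow the first path until it first
  meets the second, then return along the second.\<close>

lemma second_vertex_unique:
  assumes "acyclic_graph T" "is_path T t r (t # s # q)" "is_path T t r (t # s' # q')"
  shows "s = s'"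
proof (rule ccontr)
  assume ne: "s \<noteq> s'"
  let ?E = "\<lambda>x y. {x, y} \<in> edges T"
  have "r \<in> set (s # q)" "r \<in> set (s' # q')"
    using assms last_in_set [of "s # q"] last_in_set [of "s' # q'"] by (simp_all add: is_path_def)
  then have "\<exists>x\<in>set (s # q). x \<in> set (s' # q')" by blast
  then obtain A w D where A: "s # q = A @ w # D" "w \<in> set (s' # q')"
      "\<forall>y\<in>set A. y \<notin> set (s' # q')"
    using split_list_first_prop [of "s # q" "\<lambda>x. x \<in> set (s' # q')"] by blast
  obtain A' D' where A': "s' # q' = A' @ w # D'"
    using split_list A(2) by metis
  \<comment> \<open>The cycle without its closing edge \<open>{s', t}\<close>; its last vertex is
    \<open>s'\<close>, which is \<open>w\<close> itself when \<open>A'\<close> is empty.\<close>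
  let ?c = "t # A @ w # rev A'"
  have p1: "distinct (t # A @ w # D)" "set (t # A @ w # D) \<subseteq> verts T"
      "successively ?E (t # A @ w # D)"
    using assms(2) unfolding is_path_def A(1) by auto
  have p2: "distinct (t # A' @ w # D')" "set (t # A' @ w # D') \<subseteq> verts T"
      "successively ?E (t # A' @ w # D')"
    using assms(3) unfolding is_path_def A' by auto
  have "distinct ?c"
    using p1(1) p2(1) A(3) unfolding A' by auto
  moreover have "set ?c \<subseteq> verts T" using p1(2) p2(2) by auto
  moreover have "successively ?E ?c"
  proof -
    have "successively ?E (A' @ [w])"
      using p2(3) by (simp add: successively_Cons successively_append_iff split: if_splits)
    then have "successively ?E (rev (A' @ [w]))"
      by (subst successively_rev) (simp add: insert_commute)
    then have "successively ?E (w # rev A')" by simp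
    moreover have "successively ?E ((t # A) @ [w])"
      using p1(3) successively_append_iff [of ?E "t # A" "w # D"]
        successively_append_iff [of ?E "t # A" "[w]"] by simp
    ultimately have "successively ?E ((t # A) @ (w # rev A'))"
      using successively_append_iff [of ?E "t # A" "w # rev A'"]
        successively_append_iff [of ?E "t # A" "[w]"] by simp
    then show ?thesis by simp
  qed
  ultimately have "is_path T t (last ?c) ?c" by (simp add: is_path_def)
  moreover have "last ?c = s'"
    using A' by (cases A') auto
  moreover have "{s', t} \<in> edges T"
    using assms(3) by (simp add: is_path_Cons_Cons insert_commute)
  moreover have "length ?c \<ge> 3"
    using ne A(1) A' by (cases A; cases A') auto
  ultimately show False using assms(1) unfolding acyclic_graph_def by metis
qed

lemma path_unique:
  assumes "acyclic_graph T" "is_path T t r p" "is_path T t r p'"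
  shows "p = p'"
  using assms(2,3)
proof (induction p arbitrary: t p')
  case Nil
  then show ?case by (simp add: is_path_def)
next
  case (Cons x q)
  have trivial: "q = []" if "is_path T r r (x # q)" for x q
    using that last_in_set [of q] by (auto simp: is_path_def split: if_splits)
  obtain q' where p': "p' = x # q'" "x = t"
    using Cons.prems by (cases p') (auto simp: is_path_def)
  show ?case
  proof (cases "t = r")
    case True
    then show ?thesis using Cons.prems p' trivial by metis
  next
    case False
    then obtain s z s' z' where q: "q = s # z" "q' = s' # z'"
      using Cons.prems p' by (cases q; cases q') (auto simp: is_path_def)
    then have "s = s'"
      using second_vertex_unique [OF assms(1)] Cons.prems p' by metis
    then have "q = q'"
      using Cons.IH [of s q'] Cons.prems p' q by (simp add: is_path_Cons_Cons)
    then show ?thesis using p' by simp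
  qed
qed

section \<open>Depth, parents and tree edges\<close>

definition tree_depth :: "'t graph \<Rightarrow> 't \<Rightarrow> 't \<Rightarrow> nat" where
  "tree_depth T r t = length (THE p. is_path T t r p)"

lemma tree_depth_eq:
  assumes "rooted_tree T r" "is_path T t r p"
  shows "tree_depth T r t = length p"
proof -
  have "(THE p. is_path T t r p) = p"
    using assms path_unique by (intro the_equality) (auto simp: rooted_tree_def)
  then show ?thesis by (simp add: tree_depth_def)
qed

lemma parent_eq:
  assumes "rooted_tree T r" "is_path T t r (t # s # q)"
  shows "parent T r t = s"
  unfolding parent_def using assms second_vertex_unique
  by (intro the_equality) (auto simp: rooted_tree_def)

lemma path_to_root:
  assumes "rooted_tree T r" "t \<in> verts T"
  obtains p where "is_path T t r p"
  using assms unfolding rooted_tree_def connected_graph_def by blast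

lemma parent_props:
  assumes "rooted_tree T r" "t \<in> verts T" "t \<noteq> r"
  shows "parent T r t \<in> verts T" "tree_depth T r (parent T r t) < tree_depth T r t"
proof -
  obtain p where p: "is_path T t r p" using path_to_root assms by metis
  then obtain s q where pq: "p = t # s # q"
    using assms(3) by (cases p; cases "tl p") (auto simp: is_path_def)
  then have s: "parent T r t = s" "is_path T s r (s # q)"
    using p parent_eq [OF assms(1), of t s q] by (simp_all add: is_path_Cons_Cons)
  then show "parent T r t \<in> verts T" by (simp add: is_path_def)
  show "tree_depth T r (parent T r t) < tree_depth T r t"
    using tree_depth_eq [OF assms(1) p] tree_depth_eq [OF assms(1) s(2)] s pq by simp
qed

text \<open>Consider the path from \<open>x\<close> to the root. If it avoids \<open>y\<close>,
  prefixing \<open>y\<close> gives the path from \<open>y\<close>. Otherwise \<open>y\<close> comes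
  right after \<open>x\<close>, since a longer segment between them would close a cycle with the
  edge.\<close>

lemma tree_edge_parent:
  assumes "rooted_tree T r" "{x, y} \<in> edges T"
  shows "(x \<noteq> r \<and> parent T r x = y) \<or> (y \<noteq> r \<and> parent T r y = x)"
proof -
  have xy: "x \<in> verts T" "y \<in> verts T" "x \<noteq> y"
    using assms by (auto simp: rooted_tree_def simple_graph_def)
  obtain p where p: "is_path T x r p" using path_to_root assms(1) xy(1) by metis
  then obtain q where q: "p = x # q" by (cases p) (auto simp: is_path_def)
  show ?thesis
  proof (cases "y \<in> set q")
    case False
    then have "is_path T y r (y # x # q)"
      using p q xy assms(2) by (simp add: is_path_Cons_Cons insert_commute)
    moreover have "y \<noteq> r"
      using False xy p last_in_set [of q] unfolding q by (auto simp: is_path_def split: if_splits)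
    ultimately show ?thesis using parent_eq [OF assms(1)] by blast
  next
    case True
    then obtain A D where A: "q = A @ y # D" using split_list by metis
    have "A = []"
    proof (rule ccontr)
      assume "A \<noteq> []"
      then have "length (x # A @ [y]) \<ge> 3" by (cases A) auto
      moreover have "is_path T x y (x # A @ [y])"
        using p successively_append_iff [of _ "x # A" "y # D"]
          successively_append_iff [of _ "x # A" "[y]"] unfolding q A by (simp add: is_path_def)
      moreover have "{y, x} \<in> edges T" using assms(2) by (simp add: insert_commute)
      ultimately show False
        using assms(1) unfolding rooted_tree_def acyclic_graph_def by blast
    qed
    then have "parent T r x = y" using p A q parent_eq [OF assms(1)] by simp
    moreover have "x \<noteq> r"
      using p A q last_in_set [of q] by (auto simp: is_path_def split: if_splits)
    ultimately show ?thesis by simp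
  qed
qed

text \<open>Every node of a connected set is a descendant of a topmost node of the set: walking along a
  path inside the set, one can only leave the subtree below the topmost node through its parent.\<close>

lemma top_of_connected_set:
  assumes T: "rooted_tree T r" and con: "connected_graph (induced_subgraph T S)"
    and S: "S \<subseteq> verts T" and t: "t \<in> S" "t = r \<or> parent T r t \<notin> S" and x: "x \<in> S"
  shows "x = t \<or> tree_depth T r t < tree_depth T r x"
proof -
  define R where "R = (\<lambda>x y. x \<in> verts T \<and> x \<noteq> r \<and> y = parent T r x)"
  obtain p where p: "is_path (induced_subgraph T S) t x p"
    using con t x S unfolding connected_graph_def induced_subgraph_def by fastforce
  have "R\<^sup>*\<^sup>* (last p) t"
    if "p \<noteq> []" "R\<^sup>*\<^sup>* (hd p) t" "set p \<subseteq> S" "successively (\<lambda>x y. {x, y} \<in> edges T) p" for p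
    using that
  proof (induction p rule: induct_list012)
    case (3 y z p)
    have "R\<^sup>*\<^sup>* z t"
      using tree_edge_parent [OF T, of y z]
    proof
      show "{y, z} \<in> edges T" using 3 by simp
    next
      assume "z \<noteq> r \<and> parent T r z = y"
      then have "R z y" using 3(5) S by (auto simp: R_def)
      then show ?thesis using 3(4) by (simp add: converse_rtranclp_into_rtranclp)
    next
      assume yz: "y \<noteq> r \<and> parent T r y = z"
      \<comment> \<open>A step up cannot start at \<open>t\<close>: either \<open>t\<close> is the
        root, or its parent lies outside \<open>S\<close>, whereas \<open>z\<close> is in
        \<open>S\<close>.\<close>
      then have "y \<noteq> t" using t 3(5) by auto
      then obtain w where "R y w" "R\<^sup>*\<^sup>* w t"
        using 3(4) by (auto elim: converse_rtranclpE)
      then show ?thesis using yz by (simp add: R_def)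
    qed
    then show ?case using 3 by simp
  qed simp_all
  moreover have "p \<noteq> []" "hd p = t" "last p = x" "set p \<subseteq> S"
      "successively (\<lambda>x y. {x, y} \<in> edges T) p"
    using p by (auto simp: is_path_def induced_subgraph_def elim: successively_mono)
  ultimately have "R\<^sup>*\<^sup>* x t" by fastforce
  then show ?thesis
  proof (induction rule: converse_rtranclp_induct)
    case (step y z)
    then show ?case using parent_props [OF T, of y] by (auto simp: R_def)
  qed simp
qed

section \<open>Decomposing cycles along a tree-decomposition\<close>

locale routed_decomposition =
  fixes G :: "'a graph" and T :: "'t graph" and r :: 't and \<beta> :: "'t \<Rightarrow> 'a set"
    and P :: "'t \<times> 'a set \<Rightarrow> 'a list" and c :: nat
  assumes simple: "simple_graph G"
    and decomposition: "tree_decomposition G T r \<beta>"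
    and captures: "captures_adhesions G T r \<beta> P"
    and path_congestion: "\<And>f. f \<in> edges G \<Longrightarrow>
      card {i \<in> adhesion_pairs T r \<beta>. f \<in> path_edges (P i)} \<le> c"
begin

abbreviation "V \<equiv> verts T"
abbreviation "adh \<equiv> adhesion T r \<beta>"
abbreviation "pairs \<equiv> adhesion_pairs T r \<beta>"
abbreviation "tor \<equiv> torso G T r \<beta>"
abbreviation "depth \<equiv> tree_depth T r"

lemma rooted: "rooted_tree T r"
  using decomposition by (simp add: tree_decomposition_def)

lemma finite_nodes: "finite V"
  using rooted by (simp add: rooted_tree_def simple_graph_def)

lemma bag_subset: "t \<in> V \<Longrightarrow> \<beta> t \<subseteq> verts G"
  using decomposition by (simp add: tree_decomposition_def)

lemma finite_bag: "t \<in> V \<Longrightarrow> finite (\<beta> t)"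
  using finite_subset [OF bag_subset, of t] simple by (simp add: simple_graph_def)

lemma adhesion_subset: "adh t \<subseteq> \<beta> t"
  by (simp add: adhesion_def)

lemma adhesion_child_subset: "s \<in> children T r t \<Longrightarrow> adh s \<subseteq> \<beta> t"
  by (auto simp: adhesion_def children_def)

lemma adhesion_pairs_iff: "(t, e) \<in> pairs \<longleftrightarrow> t \<in> V \<and> card e = 2 \<and> e \<subseteq> adh t"
  unfolding adhesion_pairs_def card_2_iff by auto

lemma edge_card: "e \<in> edges G \<Longrightarrow> card e = 2"
  using simple by (simp add: simple_graph_def)

lemma torso_edges_iff:
  "e \<in> edges (tor t) \<longleftrightarrow> card e = 2 \<and>
     (e \<in> edges G \<and> e \<subseteq> \<beta> t \<or> e \<subseteq> adh t \<or> (\<exists>s\<in>children T r t. e \<subseteq> adh s))"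
proof -
  have "e \<in> edges (tor t) \<longleftrightarrow> (e \<in> edges G \<and> e \<subseteq> \<beta> t) \<or>
      (card e = 2 \<and> (\<exists>s\<in>insert t (children T r t). e \<subseteq> adh s))"
    unfolding torso_def induced_subgraph_def card_2_iff by auto
  then show ?thesis using edge_card by auto
qed

lemma torso_edge_subset: "e \<in> edges (tor t) \<Longrightarrow> e \<subseteq> \<beta> t"
  using adhesion_subset adhesion_child_subset unfolding torso_edges_iff by blast

lemma verts_torso: "verts (tor t) = \<beta> t"
  by (simp add: torso_def)

lemma simple_torso:
  assumes "t \<in> V"
  shows "simple_graph (tor t)"
  unfolding simple_graph_def verts_torso
proof (intro conjI ballI)
  fix e assume e: "e \<in> edges (tor t)"
  show "e \<subseteq> \<beta> t" by (rule torso_edge_subset [OF e])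
  show "card e = 2" using e by (simp only: torso_edges_iff)
qed (rule finite_bag [OF assms])

lemma finite_torso_edges: "t \<in> V \<Longrightarrow> finite (edges (tor t))"
  using simple_torso finite_edges by blast

lemma finite_pairs: "finite pairs"
proof (rule finite_subset)
  show "pairs \<subseteq> V \<times> Pow (verts G)"
  proof clarify
    fix t e assume "(t, e) \<in> pairs"
    then show "t \<in> V \<and> e \<in> Pow (verts G)"
      using adhesion_subset [of t] bag_subset [of t] by (auto simp: adhesion_pairs_iff)
  qed
  show "finite (V \<times> Pow (verts G))"
    using finite_nodes simple by (simp add: simple_graph_def)
qed

text \<open>Outside the adhesion means that \<open>t\<close> is the root or the parent's bag misses
  \<open>v\<close>, so \<open>t\<close> is topmost in the connected set of nodes whose bags contain
  \<open>v\<close>.\<close>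

lemma top_of_vertex:
  assumes "t \<in> V" "v \<in> \<beta> t" "v \<notin> adh t" "x \<in> V" "v \<in> \<beta> x"
  shows "x = t \<or> depth t < depth x"
proof (rule top_of_connected_set [OF rooted])
  show "connected_graph (induced_subgraph T {t\<in>V. v \<in> \<beta> t})"
    using decomposition bag_subset assms(1,2) by (simp add: tree_decomposition_def subset_iff)
  show "t = r \<or> parent T r t \<notin> {t\<in>V. v \<in> \<beta> t}"
    using assms by (auto simp: adhesion_def split: if_splits)
qed (use assms in auto)

text \<open>Each of the two nodes is topmost for some vertex of \<open>e\<close>; if they differed,
  each would be strictly deeper than the other. This is why an edge of \<open>G\<close> is routed
  along itself at no more than one node.\<close>

lemma top_of_set_unique:
  assumes "t \<in> V" "e \<subseteq> \<beta> t" "\<not> e \<subseteq> adh t" "t' \<in> V" "e \<subseteq> \<beta> t'" "\<not> e \<subseteq> adh t'"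
  shows "t = t'"
proof -
  obtain u v where "u \<in> e" "u \<notin> adh t" "v \<in> e" "v \<notin> adh t'" using assms by auto
  then have "t' = t \<or> depth t < depth t'" "t = t' \<or> depth t' < depth t"
    using assms top_of_vertex [of t u t'] top_of_vertex [of t' v t] by auto
  then show ?thesis by auto
qed

text \<open>The nodes are treated by decreasing depth. When \<open>s\<close> is treated, the odd vertices of \<open>Y s\<close> lie
  in the adhesion of \<open>s\<close>, because a vertex of \<open>s\<close> outside it occurs otherwise only in treated nodes.
  They are repaired by a star of virtual edges, added both at \<open>s\<close> and at its parent.\<close>

lemma repair_family:
  assumes "D \<subseteq> V" "\<And>x y. x \<in> D \<Longrightarrow> y \<in> V \<Longrightarrow> depth x < depth y \<Longrightarrow> y \<in> D"
    and "\<And>t. t \<in> V \<Longrightarrow> Y t \<subseteq> edges (tor t)"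
    and "f2_sum (f2_family_sum V Y) = {}"
    and "\<And>t. t \<in> D \<Longrightarrow> f2_sum (Y t) = {}"
  shows "\<exists>Y'. (\<forall>t\<in>V. Y' t \<in> cycle_space (tor t)) \<and> f2_family_sum V Y' = f2_family_sum V Y"
  using assms
proof (induction "card (V - D)" arbitrary: D Y)
  case 0
  then have "D = V" using finite_nodes by auto
  then have "\<forall>t\<in>V. Y t \<in> cycle_space (tor t)"
    using 0 simple_torso by (simp add: cycle_space_iff)
  then show ?case by blast
next
  case (Suc n)
  note up = Suc.prems(2) and Yt = Suc.prems(3) and even = Suc.prems(5)
  have finY: "finite (Y t)" if "t \<in> V" for t
    using Yt finite_torso_edges finite_subset that by blast
  have ne: "V - D \<noteq> {}" using Suc.hyps(2) by (metis card.empty nat.distinct(1))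
  \<comment> \<open>This yields a deepest untreated node \<open>s\<close>; every strictly deeper
    node is treated already.\<close>
  define d where "d = Max (depth ` (V - D))"
  have "d \<in> depth ` (V - D)" "\<And>y. y \<in> V - D \<Longrightarrow> depth y \<le> d"
    unfolding d_def using ne finite_nodes by (auto intro!: Max_in)
  then obtain s where s: "s \<in> V - D" "\<And>y. y \<in> V - D \<Longrightarrow> depth y \<le> depth s"
    by auto
  let ?O = "f2_sum (Y s)"
  have O_sub: "?O \<subseteq> adh s"
  proof
    fix v assume v: "v \<in> ?O"
    have in_bag: "v \<in> \<beta> t" if "t \<in> V" "v \<in> f2_sum (Y t)" for t
      using f2_sum_subset [of "Y t"] Yt [of t] torso_edge_subset [of _ t] that by blast
    show "v \<in> adh s"
    proof (rule ccontr)
      assume "v \<notin> adh s"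
      have "v \<notin> f2_sum (Y t)" if t: "t \<in> V" "t \<noteq> s" for t
      proof
        assume vt: "v \<in> f2_sum (Y t)"
        have "t = s \<or> depth s < depth t"
          by (rule top_of_vertex) (use s(1) v t vt in_bag \<open>v \<notin> adh s\<close> in auto)
        then have "t \<in> D" using s(2) [of t] t by auto
        then show False using even [of t] vt by simp
      qed
      \<comment> \<open>All other nodes containing \<open>v\<close> are treated and have empty
        boundary, so \<open>v\<close> would survive in the total boundary.\<close>
      then have "{t\<in>V. v \<in> f2_sum (Y t)} = {s}" using s v by auto
      then have "v \<in> f2_family_sum V (\<lambda>t. f2_sum (Y t))" by (simp add: f2_family_sum_def)
      then show False
        using Suc.prems(4) f2_sum_family_sum [OF finite_nodes finY] by auto
    qed
  qed
  have "even (card ?O)"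
  proof (rule even_card_f2_sum)
    show "finite (Y s)" using finY s by simp
    show "card e = 2" if "e \<in> Y s" for e
      using Yt [of s] s that torso_edges_iff [of e s] by auto
  qed
  moreover have "finite ?O"
    using finite_subset [OF subset_trans [OF O_sub adhesion_subset] finite_bag] s by auto
  ultimately obtain M where M: "\<And>e. e \<in> M \<Longrightarrow> card e = 2 \<and> e \<subseteq> ?O" "finite M" "f2_sum M = ?O"
    using star_with_boundary by metis
  have "V - insert s D = V - D - {s}" by auto
  then have new: "n = card (V - insert s D)" "insert s D \<subseteq> V"
    using s(1) Suc.hyps(2) Suc.prems(1) by auto
  have up': "y \<in> insert s D" if "x \<in> insert s D" "y \<in> V" "depth x < depth y" for x y
    using that up [of x y] s(2) [of y] by auto
  show ?case
  proof (cases "s = r")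
    case True
    then have "?O = {}" using O_sub by (simp add: adhesion_def)
    then show ?thesis
      using Yt even Suc.prems(4) by (intro Suc.hyps(1) [OF new up']) auto
  next
    case False
    let ?q = "parent T r s"
    have q: "?q \<in> V" "depth ?q < depth s"
      using parent_props [OF rooted _ False] s by auto
    \<comment> \<open>Had the parent been treated, \<open>s\<close>, being deeper, would be treated
      too. So changing the set at the parent spoils no treated node.\<close>
    then have "?q \<notin> D" "?q \<noteq> s" using up s by auto
    let ?H = "\<lambda>t. if t = s \<or> t = ?q then M else {}"
    let ?Y = "\<lambda>t. sym_diff (Y t) (?H t)"
    have "{t\<in>V. e \<in> ?H t} = (if e \<in> M then {s, ?q} else {})" for e
      using q s by auto
    then have "f2_family_sum V ?H = {}"
      using \<open>?q \<noteq> s\<close> by (auto simp: f2_family_sum_def)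
    then have eq: "f2_family_sum V ?Y = f2_family_sum V Y"
      using f2_family_sum_sym_diff [OF finite_nodes, of Y ?H] by simp
    have "s \<in> children T r ?q" using s False by (simp add: children_def)
    then have "M \<subseteq> edges (tor s)" "M \<subseteq> edges (tor ?q)"
      using M(1) O_sub unfolding torso_edges_iff subset_iff by blast+
    then have sub: "?Y t \<subseteq> edges (tor t)" if "t \<in> V" for t
      using Yt [OF that] by auto
    have "f2_sum (?Y s) = {}"
      using f2_sum_sym_diff [OF finY [of s] M(2)] s M(3) by simp
    moreover have "f2_sum (?Y t) = {}" if "t \<in> D" "t \<noteq> s" for t
      using that even [of t] \<open>?q \<notin> D\<close> by auto
    ultimately have even': "f2_sum (?Y t) = {}" if "t \<in> insert s D" for t
      using that by (cases "t = s") auto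
    have "f2_sum (f2_family_sum V ?Y) = {}" using eq Suc.prems(4) by simp
    from Suc.hyps(1) [OF new up' sub this even'] show ?thesis unfolding eq .
  qed
qed

text \<open>Assign each edge of \<open>Z\<close> to one node whose bag contains it. The pieces sum
  to \<open>Z\<close> but need not be cycles; \<open>repair_family\<close>, started with no treated
  node, turns them into cycles without changing the sum.\<close>

lemma cycle_decomposition:
  assumes "Z \<in> cycle_space G"
  obtains Y where "\<And>t. t \<in> V \<Longrightarrow> Y t \<in> cycle_space (tor t)" "f2_family_sum V Y = Z"
proof -
  have Z: "Z \<subseteq> edges G" "f2_sum Z = {}" using assms cycle_space_iff simple by auto
  obtain home where home: "\<And>e. e \<in> edges G \<Longrightarrow> home e \<in> V \<and> e \<subseteq> \<beta> (home e)"
    using decomposition unfolding tree_decomposition_def by metis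
  let ?Y = "\<lambda>t. {e\<in>Z. home e = t}"
  have "{t\<in>V. e \<in> ?Y t} = (if e \<in> Z then {home e} else {})" for e
    using home Z by auto
  then have sum: "f2_family_sum V ?Y = Z" by (auto simp: f2_family_sum_def)
  moreover have "?Y t \<subseteq> edges (tor t)" for t
    using Z home edge_card by (auto simp: torso_edges_iff)
  ultimately have "\<exists>Y'. (\<forall>t\<in>V. Y' t \<in> cycle_space (tor t)) \<and> f2_family_sum V Y' = f2_family_sum V ?Y"
    using Z by (intro repair_family [of "{}"]) auto
  then show ?thesis using that sum by metis
qed

end

section \<open>Rerouting the virtual edges\<close>

text \<open>\<open>pred\<close> encodes a line on \<open>J\<close> starting at \<open>a\<close>.
  Injectivity means that an element precedes at most one other, which bounds congestion; the
  induction principle says that the whole line is reached from \<open>a\<close>, which allows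
  telescoping.\<close>

lemma linear_predecessor:
  assumes "finite J" "a \<in> J"
  shows "\<exists>pred. inj_on pred (J - {a}) \<and> pred ` (J - {a}) \<subseteq> J \<and>
    (\<forall>Q. Q a \<longrightarrow> (\<forall>i\<in>J - {a}. Q (pred i) \<longrightarrow> Q i) \<longrightarrow> (\<forall>j\<in>J. Q j))"
proof -
  \<comment> \<open>The extra \<open>l\<close> is the current end of the line, not yet the
    predecessor of anything; a new element is attached behind it.\<close>
  have chain: "\<exists>pred l. inj_on pred K \<and> pred ` K \<subseteq> insert a K \<and> l \<in> insert a K \<and> l \<notin> pred ` K \<and>
      (\<forall>Q. Q a \<longrightarrow> (\<forall>i\<in>K. Q (pred i) \<longrightarrow> Q i) \<longrightarrow> (\<forall>j\<in>insert a K. Q j))"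
    if "finite K" "a \<notin> K" for K
    using that
  proof (induction K rule: finite_induct)
    case empty
    show ?case by (rule exI [of _ id], rule exI [of _ a]) auto
  next
    case (insert x K)
    have "a \<notin> K" using insert.prems by simp
    from insert.IH [OF this] obtain pred l where IH: "inj_on pred K" "pred ` K \<subseteq> insert a K"
        "l \<in> insert a K" "l \<notin> pred ` K"
        and gen: "\<forall>Q. Q a \<longrightarrow> (\<forall>i\<in>K. Q (pred i) \<longrightarrow> Q i) \<longrightarrow> (\<forall>j\<in>insert a K. Q j)"
      by (elim exE conjE)
    let ?p = "pred(x := l)"
    have img: "?p ` insert x K = insert l (pred ` K)" using insert.hyps by auto
    have "inj_on ?p (insert x K)"
      using IH(1,4) insert.hyps by (auto simp: inj_on_def)
    moreover have "?p ` insert x K \<subseteq> insert a (insert x K)"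
      unfolding img using IH by auto
    moreover have "x \<in> insert a (insert x K)" by simp
    moreover have "x \<notin> ?p ` insert x K"
      unfolding img using IH insert.hyps insert.prems by auto
    moreover have "\<forall>Q. Q a \<longrightarrow> (\<forall>i\<in>insert x K. Q (?p i) \<longrightarrow> Q i) \<longrightarrow>
        (\<forall>j\<in>insert a (insert x K). Q j)"
    proof (intro allI impI)
      fix Q assume Q: "Q a" "\<forall>i\<in>insert x K. Q (?p i) \<longrightarrow> Q i"
      have "\<forall>i\<in>K. Q (pred i) \<longrightarrow> Q i" using Q(2) insert.hyps by (metis fun_upd_other insertI2)
      then have "\<forall>j\<in>insert a K. Q j" using spec [OF gen, of Q] Q(1) by blast
      then show "\<forall>j\<in>insert a (insert x K). Q j" using Q(2) IH(3) by auto
    qed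
    ultimately show ?case by (intro exI conjI)
  qed
  have "finite (J - {a})" "a \<notin> J - {a}" using assms(1) by auto
  from chain [OF this] obtain pred l where p: "inj_on pred (J - {a})"
      "pred ` (J - {a}) \<subseteq> insert a (J - {a})" "l \<in> insert a (J - {a})" "l \<notin> pred ` (J - {a})"
      "\<forall>Q. Q a \<longrightarrow> (\<forall>i\<in>J - {a}. Q (pred i) \<longrightarrow> Q i) \<longrightarrow> (\<forall>j\<in>insert a (J - {a}). Q j)"
    by (elim exE conjE)
  have "insert a (J - {a}) = J" using assms(2) by auto
  with p(1,2,5) show ?thesis by (intro exI [of _ pred] conjI) simp_all
qed

context routed_decomposition
begin

text \<open>The route \<open>None\<close> realises \<open>e\<close> by itself, the route \<open>Some t\<close> by the path chosen at \<open>t\<close>.\<close>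

definition routes :: "'a set \<Rightarrow> 't option set" where
  "routes e = {k. case k of None \<Rightarrow> e \<in> edges G | Some t \<Rightarrow> (t, e) \<in> pairs}"

definition route_edges :: "'t option \<Rightarrow> 'a set \<Rightarrow> 'a set set" where
  "route_edges k e = (case k of None \<Rightarrow> {e} | Some t \<Rightarrow> path_edges (P (t, e)))"

lemma routes_simps [simp]:
  "None \<in> routes e \<longleftrightarrow> e \<in> edges G" "Some t \<in> routes e \<longleftrightarrow> (t, e) \<in> pairs"
  by (simp_all add: routes_def)

lemma route_edges_simps [simp]:
  "route_edges None e = {e}" "route_edges (Some t) e = path_edges (P (t, e))"
  by (simp_all add: route_edges_def)

lemma finite_routes: "finite (routes e)"
proof (rule finite_subset)
  show "routes e \<subseteq> insert None (Some ` V)"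
  proof
    fix k assume "k \<in> routes e"
    then show "k \<in> insert None (Some ` V)" by (cases k) (auto simp: adhesion_pairs_iff)
  qed
  show "finite (insert None (Some ` V))" using finite_nodes by simp
qed

lemma finite_route_edges: "finite (route_edges k e)"
  by (cases k) (simp_all add: finite_path_edges)

lemma route_edges_subset:
  assumes "k \<in> routes e"
  shows "route_edges k e \<subseteq> edges G"
proof (cases k)
  case None
  then show ?thesis using assms by simp
next
  case (Some t)
  then obtain u v where "is_path G u v (P (t, e))"
    using assms captures unfolding captures_adhesions_def by fastforce
  then show ?thesis using path_edges_subset [of G "P (t, e)"] Some by (simp add: is_path_def)
qed

text \<open>The boundary does not depend on the route. Hence rerouting preserves cycles, and two
  routes of one pair differ by a cycle.\<close>

lemma f2_sum_route_edges:
  assumes "k \<in> routes e"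
  shows "f2_sum (route_edges k e) = e"
proof (cases k)
  case None
  then show ?thesis by (simp add: f2_sum_insert f2_sum_empty)
next
  case (Some t)
  then obtain u v where uv: "e = {u, v}" "is_path G u v (P (t, e))"
    using assms captures unfolding captures_adhesions_def by fastforce
  moreover have "card e = 2" using assms Some by (simp add: adhesion_pairs_iff)
  ultimately have "u \<noteq> v" by auto
  then have "sym_diff {u} {v} = e" using uv(1) by auto
  then show ?thesis using f2_sum_path_edges [of "P (t, e)"] uv(2) Some by (simp add: is_path_def)
qed

text \<open>The paths through \<open>f\<close> account for \<open>c\<close>, the trivial route of
  \<open>f\<close> for the extra 1.\<close>

lemma card_routes_through:
  assumes "f \<in> edges G"
  shows "finite {(k, e). k \<in> routes e \<and> f \<in> route_edges k e}" (is "finite ?R")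
    and "card {(k, e). k \<in> routes e \<and> f \<in> route_edges k e} \<le> c + 1"
proof -
  let ?Q = "{i \<in> pairs. f \<in> path_edges (P i)}"
  let ?U = "insert (None, f) ((\<lambda>(t, e). (Some t, e)) ` ?Q)"
  have sub: "?R \<subseteq> ?U"
  proof clarify
    fix k e assume "k \<in> routes e" "f \<in> route_edges k e" "(k, e) \<notin> (\<lambda>(t, e). (Some t, e)) ` ?Q"
    then show "k = None \<and> e = f" by (cases k) (auto simp: image_iff)
  qed
  have fin: "finite ?Q" using finite_pairs by simp
  then show "finite ?R" using finite_subset [OF sub] by simp
  have "card ?R \<le> card ?U" using sub fin by (intro card_mono) auto
  also have "\<dots> \<le> Suc (card ((\<lambda>(t, e). (Some t, e)) ` ?Q))" by (rule card_insert_le_m1) auto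
  also have "\<dots> \<le> c + 1"
    using card_image_le [OF fin, of "\<lambda>(t, e). (Some t, e)"] path_congestion [OF assms] by simp
  finally show "card ?R \<le> c + 1" .
qed

text \<open>An edge of \<open>G\<close> is used directly only at the topmost node containing it; everywhere else it is
  replaced by a path as well, since it may lie in arbitrarily many bags.\<close>

definition route_at :: "'t \<Rightarrow> 'a set \<Rightarrow> 't option" where
  "route_at t e = (if (t, e) \<in> pairs then Some t else if e \<in> edges G then None
     else Some (SOME s. s \<in> children T r t \<and> (s, e) \<in> pairs))"

lemma route_at_cases:
  assumes "t \<in> V" "e \<in> edges (tor t)"
  obtains "route_at t e = Some t" "(t, e) \<in> pairs"
  | "route_at t e = None" "e \<in> edges G" "\<not> e \<subseteq> adh t"
  | s where "route_at t e = Some s" "s \<in> children T r t" "(s, e) \<in> pairs"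
proof (cases "(t, e) \<in> pairs \<or> e \<in> edges G")
  case True
  then show ?thesis
    using that(1,2) assms(1) edge_card by (auto simp: route_at_def adhesion_pairs_iff)
next
  case False
  have "card e = 2" using assms(2) by (simp add: torso_edges_iff)
  then have "\<not> e \<subseteq> adh t" using False assms(1) by (simp add: adhesion_pairs_iff)
  then have "\<exists>s. s \<in> children T r t \<and> (s, e) \<in> pairs"
    using assms(2) False by (auto simp: torso_edges_iff adhesion_pairs_iff children_def)
  from someI_ex [OF this] show ?thesis
    using that(3) False by (auto simp: route_at_def)
qed

lemma route_at_in_routes:
  assumes "t \<in> V" "e \<in> edges (tor t)"
  shows "route_at t e \<in> routes e"
  using assms by (cases rule: route_at_cases) simp_all

text \<open>The path of \<open>(s, e)\<close> serves at most at \<open>s\<close> and at the parent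
  of \<open>s\<close>, which gives \<open>2 * c\<close>; \<open>f\<close> is its own route at no
  more than one node, which gives the extra 1.\<close>

lemma card_routes_at_through:
  assumes "f \<in> edges G"
  shows "card {(t, e). t \<in> V \<and> e \<in> edges (tor t) \<and> f \<in> route_edges (route_at t e) e} \<le> 2 * c + 1"
    (is "card ?X \<le> _")
proof -
  let ?Q = "{i \<in> pairs. f \<in> path_edges (P i)}"
  let ?up = "\<lambda>(s, e). (parent T r s, e)"
  \<comment> \<open>The topmost node containing \<open>f\<close>; arbitrary if no node satisfies the
    three conditions.\<close>
  obtain t0 where t0: "\<And>t. t \<in> V \<Longrightarrow> f \<subseteq> \<beta> t \<Longrightarrow> \<not> f \<subseteq> adh t \<Longrightarrow> t = t0"
    using top_of_set_unique by metis
  have sub: "?X \<subseteq> insert (t0, f) (?Q \<union> ?up ` ?Q)"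
  proof
    fix i assume "i \<in> ?X"
    then obtain t e where i: "i = (t, e)" and te: "t \<in> V" "e \<in> edges (tor t)"
        and f: "f \<in> route_edges (route_at t e) e"
      by auto
    from te show "i \<in> insert (t0, f) (?Q \<union> ?up ` ?Q)"
    proof (cases rule: route_at_cases)
      case 1
      then show ?thesis using i f by simp
    next
      case 2
      then show ?thesis using i f te t0 torso_edge_subset [of e t] by simp
    next
      case (3 s)
      then have "(s, e) \<in> ?Q" "i = ?up (s, e)" using i f by (auto simp: children_def)
      then show ?thesis by blast
    qed
  qed
  have fin: "finite ?Q" using finite_pairs by simp
  have "card ?X \<le> card (insert (t0, f) (?Q \<union> ?up ` ?Q))"
    using fin by (intro card_mono [OF _ sub]) simp
  also have "\<dots> \<le> Suc (card (?Q \<union> ?up ` ?Q))" by (rule card_insert_le_m1) auto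
  also have "card (?Q \<union> ?up ` ?Q) \<le> card ?Q + card (?up ` ?Q)" by (rule card_Un_le)
  also have "card (?up ` ?Q) \<le> card ?Q" using fin by (rule card_image_le)
  finally show ?thesis using path_congestion [OF assms] by simp
qed

section \<open>The generating cycles, their span and their congestion\<close>

lemma basis_number_le_routed:
  assumes torso_bn: "\<And>t. t \<in> V \<Longrightarrow> basis_number (tor t) \<le> b"
  shows "basis_number G \<le> (2 * c + 1) * (b + 1)"
proof -
  have "\<forall>t\<in>V. \<exists>B. cycle_basis (tor t) B \<and> congestion (tor t) B (\<lambda>C. C) = basis_number (tor t)"
    using basis_number_attained [OF simple_torso] by metis
  then obtain Bs where Bs: "\<And>t. t \<in> V \<Longrightarrow> cycle_basis (tor t) (Bs t)"
      "\<And>t. t \<in> V \<Longrightarrow> congestion (tor t) (Bs t) (\<lambda>C. C) = basis_number (tor t)"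
    by metis
  have Bs_sub: "C \<subseteq> edges (tor t)" "f2_sum C = {}" if "t \<in> V" "C \<in> Bs t" for t C
    using Bs(1) [OF that(1)] that(2) cycle_space_iff [OF simple_torso [OF that(1)], of C]
    by (auto simp: cycle_basis_def)
  have fin_C: "finite C" if "t \<in> V" "C \<in> Bs t" for t C
    by (rule finite_subset [OF Bs_sub(1) [OF that] finite_torso_edges [OF that(1)]])
  have fin_Bs: "finite (Bs t)" if "t \<in> V" for t
  proof (rule finite_subset)
    show "Bs t \<subseteq> Pow (edges (tor t))" using Bs_sub(1) [OF that] by auto
    show "finite (Pow (edges (tor t)))" using finite_torso_edges [OF that] by simp
  qed
  have Bs_cong: "card {C\<in>Bs t. e \<in> C} \<le> b" if "t \<in> V" "e \<in> edges (tor t)" for t e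
    using card_le_congestion [OF finite_torso_edges [OF that(1)] that(2), of "Bs t" "\<lambda>C. C"]
      Bs(2) [OF that(1)] torso_bn [OF that(1)]
    by linarith

  \<comment> \<open>The first route on the line of \<open>e\<close>. It is the trivial one for an
    edge of \<open>G\<close>, so \<open>None\<close> never needs a predecessor.\<close>
  define a where "a e = (if e \<in> edges G then None else SOME k. k \<in> routes e)" for e
  have a_in: "a e \<in> routes e" if "routes e \<noteq> {}" for e
    using that some_in_eq [of "routes e"] by (cases "e \<in> edges G") (simp_all add: a_def)
  have "\<exists>pred. \<forall>e. routes e \<noteq> {} \<longrightarrow>
      inj_on (pred e) (routes e - {a e}) \<and> pred e ` (routes e - {a e}) \<subseteq> routes e \<and>
      (\<forall>Q. Q (a e) \<longrightarrow> (\<forall>i\<in>routes e - {a e}. Q (pred e i) \<longrightarrow> Q i) \<longrightarrow> (\<forall>j\<in>routes e. Q j))"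
  proof (rule choice, rule allI)
    fix e
    show "\<exists>p. routes e \<noteq> {} \<longrightarrow> inj_on p (routes e - {a e}) \<and> p ` (routes e - {a e}) \<subseteq> routes e \<and>
      (\<forall>Q. Q (a e) \<longrightarrow> (\<forall>i\<in>routes e - {a e}. Q (p i) \<longrightarrow> Q i) \<longrightarrow> (\<forall>j\<in>routes e. Q j))"
    proof (cases "routes e = {}")
      case False
      from linear_predecessor [OF finite_routes a_in [OF False]] show ?thesis
        by (elim exE) (intro exI impI)
    qed simp
  qed
  then obtain pred where pred: "\<forall>e. routes e \<noteq> {} \<longrightarrow>
      inj_on (pred e) (routes e - {a e}) \<and> pred e ` (routes e - {a e}) \<subseteq> routes e \<and>
      (\<forall>Q. Q (a e) \<longrightarrow> (\<forall>i\<in>routes e - {a e}. Q (pred e i) \<longrightarrow> Q i) \<longrightarrow> (\<forall>j\<in>routes e. Q j))"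
    by (elim exE)
  note pred_inj = conjunct1 [OF mp [OF spec [OF pred]]]
    and pred_in = conjunct1 [OF conjunct2 [OF mp [OF spec [OF pred]]]]
    and pred_induct = conjunct2 [OF conjunct2 [OF mp [OF spec [OF pred]]]]

  define \<rho> where "\<rho> t e = route_edges (route_at t e) e" for t e
  define IA where "IA = Sigma V Bs"
  define genA where "genA = (\<lambda>(t, C). f2_family_sum C (\<rho> t))"
  define IB where "IB = {(t, e) \<in> pairs. Some t \<noteq> a e}"
  define genB where "genB = (\<lambda>(t, e). sym_diff (route_edges (Some t) e) (route_edges (pred e (Some t)) e))"
  \<comment> \<open>Coinciding generators merge in the set \<open>S\<close>, so counting their
    indices bounds the congestion from above.\<close>
  define S where "S = genA ` IA \<union> genB ` IB"
  have IB: "Some t \<in> routes e - {a e}" "pred e (Some t) \<in> routes e" if "(t, e) \<in> IB" for t e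
  proof -
    show st: "Some t \<in> routes e - {a e}" using that by (auto simp: IB_def)
    then have "routes e \<noteq> {}" by blast
    from pred_in [OF this] st show "pred e (Some t) \<in> routes e" by blast
  qed
  have fin_IA: "finite IA" unfolding IA_def using finite_nodes fin_Bs by (rule finite_SigmaI)
  have fin_IB: "finite IB" unfolding IB_def using finite_pairs by (rule rev_finite_subset) auto
  have fin_S: "finite S" using fin_IA fin_IB by (simp add: S_def)
  have \<rho>: "\<rho> t e \<subseteq> edges G" "f2_sum (\<rho> t e) = e" "finite (\<rho> t e)"
    if "t \<in> V" "e \<in> edges (tor t)" for t e
    using route_at_in_routes [OF that] route_edges_subset f2_sum_route_edges finite_route_edges
    by (simp_all add: \<rho>_def)

  have "genA i \<in> cycle_space G" if iA: "i \<in> IA" for i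
  proof -
    obtain t C where i: "i = (t, C)" "t \<in> V" "C \<in> Bs t" using iA by (auto simp: IA_def)
    note C = Bs_sub [OF i(2,3)]
    have "f2_family_sum C (\<rho> t) \<subseteq> edges G"
      using f2_family_sum_subset [of C "\<rho> t"] \<rho>(1) [OF i(2)] C(1) by blast
    moreover have "f2_sum (f2_family_sum C (\<rho> t)) = f2_family_sum C (\<lambda>e. f2_sum (\<rho> t e))"
      using \<rho>(3) [OF i(2)] C(1) fin_C [OF i(2,3)] by (intro f2_sum_family_sum) auto
    moreover have "\<dots> = f2_family_sum C (\<lambda>e. e)"
      using \<rho>(2) [OF i(2)] C(1) by (intro f2_family_sum_cong) auto
    ultimately show ?thesis
      using C(2) by (simp add: i genA_def cycle_space_iff [OF simple] f2_sum_eq_family_sum)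
  qed
  moreover have "genB i \<in> cycle_space G" if "i \<in> IB" for i
  proof -
    obtain t e where i: "i = (t, e)" by (cases i)
    then have r: "Some t \<in> routes e" "pred e (Some t) \<in> routes e" using IB that by auto
    have "genB i \<subseteq> edges G"
      using route_edges_subset [OF r(1)] route_edges_subset [OF r(2)] by (auto simp: genB_def i)
    moreover have "f2_sum (genB i) = {}"
      using f2_sum_route_edges [OF r(1)] f2_sum_route_edges [OF r(2)]
        f2_sum_sym_diff [OF finite_route_edges finite_route_edges, of "Some t" e "pred e (Some t)" e]
      by (simp add: genB_def i)
    ultimately show ?thesis by (simp add: cycle_space_iff [OF simple])
  qed
  ultimately have S_sub: "S \<subseteq> cycle_space G" by (auto simp: S_def)

  \<comment> \<open>Along the line of \<open>e\<close> the sums of consecutive routes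
    telescope.\<close>
  have switch: "sym_diff (route_edges (a e) e) (route_edges k e) \<in> f2_span S" if k: "k \<in> routes e" for k e
  proof -
    let ?Q = "\<lambda>k. sym_diff (route_edges (a e) e) (route_edges k e) \<in> f2_span S"
    have ne: "routes e \<noteq> {}" using k by auto
    have "?Q (a e)" by (simp add: f2_span_empty_mem)
    moreover have "?Q i" if i: "i \<in> routes e - {a e}" and IH: "?Q (pred e i)" for i
    proof -
      obtain t where t: "i = Some t"
        using i by (cases i) (auto simp: a_def)
      then have "(t, e) \<in> IB" using i by (auto simp: IB_def)
      then have "genB (t, e) \<in> f2_span S" by (intro f2_span_base) (simp add: S_def)
      from f2_span_sym_diff [OF fin_S IH this]
      have "sym_diff (sym_diff (route_edges (a e) e) (route_edges (pred e i) e)) (genB (t, e))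
        \<in> f2_span S" .
      moreover have "sym_diff (sym_diff A B) (sym_diff C B) = sym_diff A C" for A B C :: "'a set set"
        by auto
      ultimately show ?thesis by (simp only: genB_def t prod.case)
    qed
    ultimately show ?thesis using spec [OF pred_induct [OF ne], of ?Q] k by blast
  qed

  have "Z \<in> f2_span S" if Z: "Z \<in> cycle_space G" for Z
  proof -
    obtain Y where Y: "\<And>t. t \<in> V \<Longrightarrow> Y t \<in> cycle_space (tor t)" "f2_family_sum V Y = Z"
      using cycle_decomposition [OF Z] by blast
    \<comment> \<open>A routing that is the same at all nodes, so that virtual edges cancel when the
      nodes are summed; edges of \<open>G\<close> are routed along themselves.\<close>
    let ?x = "\<lambda>e. route_edges (a e) e"
    have Y_sub: "Y t \<subseteq> edges (tor t)" if "t \<in> V" for t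
      using Y(1) [OF that] by (simp add: cycle_space_def)
    have fin_Y: "finite (Y t)" if "t \<in> V" for t
      by (rule finite_subset [OF Y_sub [OF that] finite_torso_edges [OF that]])
    have "f2_family_sum (Y t) ?x \<in> f2_span S" if t: "t \<in> V" for t
    proof -
      have "\<forall>F\<in>cycle_space (tor t). \<exists>X\<subseteq>Bs t. F = f2_sum X"
        using Bs(1) [OF t] by (simp add: cycle_basis_def)
      from bspec [OF this Y(1) [OF t]] obtain X where X: "X \<subseteq> Bs t" "Y t = f2_sum X"
        by (elim exE conjE)
      have fin_X: "finite X" by (rule finite_subset [OF X(1) fin_Bs [OF t]])
      \<comment> \<open>Rerouting is linear, so the expansion of \<open>Y t\<close> in the torso
        basis becomes a sum of generators.\<close>
      have "f2_family_sum (Y t) (\<rho> t) = f2_family_sum X (\<lambda>C. f2_family_sum C (\<rho> t))"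
        unfolding X(2) f2_sum_eq_family_sum
        using fin_X fin_C [OF t] X(1) by (intro f2_family_sum_linear) auto
      also have "\<dots> \<in> f2_span S"
      proof (rule f2_span_family_sum [OF fin_S fin_X])
        fix C assume "C \<in> X"
        then have "genA (t, C) \<in> S" using X t by (auto simp: S_def IA_def)
        then show "f2_family_sum C (\<rho> t) \<in> f2_span S" using f2_span_base [of "genA (t, C)" S] by (simp add: genA_def)
      qed
      finally have W: "f2_family_sum (Y t) (\<rho> t) \<in> f2_span S" .
      \<comment> \<open>Passing from the routes used at \<open>t\<close> to the first routes costs
        only elements of the span.\<close>
      have "f2_family_sum (Y t) (\<lambda>e. sym_diff (?x e) (\<rho> t e)) \<in> f2_span S"
        unfolding \<rho>_def using Y_sub [OF t] route_at_in_routes [OF t]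
        by (intro f2_span_family_sum [OF fin_S fin_Y [OF t]] switch) auto
      then have "sym_diff (f2_family_sum (Y t) ?x) (f2_family_sum (Y t) (\<rho> t)) \<in> f2_span S"
        by (simp only: f2_family_sum_sym_diff [OF fin_Y [OF t]])
      from f2_span_sym_diff [OF fin_S this W]
      have "sym_diff (sym_diff (f2_family_sum (Y t) ?x) (f2_family_sum (Y t) (\<rho> t)))
        (f2_family_sum (Y t) (\<rho> t)) \<in> f2_span S" .
      moreover have "sym_diff (sym_diff A B) B = A" for A B :: "'a set set" by auto
      ultimately show ?thesis by simp
    qed
    then have "f2_family_sum V (\<lambda>t. f2_family_sum (Y t) ?x) \<in> f2_span S"
      by (intro f2_span_family_sum [OF fin_S finite_nodes])
    also have "f2_family_sum V (\<lambda>t. f2_family_sum (Y t) ?x) = f2_family_sum Z ?x"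
      unfolding Y(2) [symmetric]
      by (rule f2_family_sum_linear [OF finite_nodes fin_Y, symmetric])
    also have "\<dots> = f2_family_sum Z (\<lambda>e. {e})"
      using Z by (intro f2_family_sum_cong) (auto simp: cycle_space_def a_def)
    finally show ?thesis by (simp add: f2_family_sum_singletons)
  qed
  then have S_span: "cycle_space G \<subseteq> f2_span S" by blast

  have "card {C\<in>S. f \<in> C} \<le> (2 * c + 1) * (b + 1)" if f: "f \<in> edges G" for f
  proof -
    let ?A = "{i\<in>IA. f \<in> genA i}" and ?B = "{i\<in>IB. f \<in> genB i}"
    have "{C\<in>S. f \<in> C} = genA ` ?A \<union> genB ` ?B" by (auto simp: S_def)
    then have "card {C\<in>S. f \<in> C} \<le> card (genA ` ?A) + card (genB ` ?B)"
      by (simp add: card_Un_le)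
    also have "\<dots> \<le> card ?A + card ?B"
      using fin_IA fin_IB by (intro add_mono card_image_le) auto
    finally have split: "card {C\<in>S. f \<in> C} \<le> card ?A + card ?B" .

    let ?X = "{(t, e). t \<in> V \<and> e \<in> edges (tor t) \<and> f \<in> route_edges (route_at t e) e}"
    have fin_X: "finite ?X"
      by (rule finite_subset [of _ "Sigma V (\<lambda>t. edges (tor t))"])
        (use finite_nodes finite_torso_edges in auto)
    \<comment> \<open>If the rerouted \<open>C\<close> contains \<open>f\<close>, some edge
      \<open>e\<close> of \<open>C\<close> has a route through \<open>f\<close>. There are at most
      \<open>2 * c + 1\<close> such pairs \<open>(t, e)\<close>, and each \<open>e\<close> lies in
      at most \<open>b\<close> members of \<open>Bs t\<close>.\<close>
    have A_sub: "?A \<subseteq> (\<Union>(t, e)\<in>?X. Pair t ` {C\<in>Bs t. e \<in> C})"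
    proof
      fix i assume "i \<in> ?A"
      then obtain t C where i: "i = (t, C)" "t \<in> V" "C \<in> Bs t" "f \<in> f2_family_sum C (\<rho> t)"
        by (auto simp: IA_def genA_def)
      then obtain e where e: "e \<in> C" "f \<in> \<rho> t e" using f2_family_sum_subset [of C "\<rho> t"] by blast
      then have "(t, e) \<in> ?X" using i Bs_sub(1) by (auto simp: \<rho>_def)
      moreover have "i \<in> Pair t ` {C\<in>Bs t. e \<in> C}" using i e by auto
      ultimately show "i \<in> (\<Union>(t, e)\<in>?X. Pair t ` {C\<in>Bs t. e \<in> C})" by blast
    qed
    have "card ?A \<le> card (\<Union>(t, e)\<in>?X. Pair t ` {C\<in>Bs t. e \<in> C})"
      using A_sub fin_X fin_Bs by (intro card_mono finite_UN_I) auto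
    also have "\<dots> \<le> (\<Sum>(t, e)\<in>?X. card (Pair t ` {C\<in>Bs t. e \<in> C}))"
      using card_UN_le [OF fin_X, of "\<lambda>(t, e). Pair t ` {C\<in>Bs t. e \<in> C}"]
      by (simp add: case_prod_unfold)
    also have "\<dots> \<le> of_nat (card ?X) * b"
    proof (rule sum_bounded_above)
      fix i assume "i \<in> ?X"
      then obtain t e where i: "i = (t, e)" "t \<in> V" "e \<in> edges (tor t)" by auto
      have "card (Pair t ` {C\<in>Bs t. e \<in> C}) \<le> b"
        using card_image_le [of "{C\<in>Bs t. e \<in> C}" "Pair t"] fin_Bs [OF i(2)] Bs_cong [OF i(2,3)] by simp
      then show "(case i of (t, e) \<Rightarrow> card (Pair t ` {C\<in>Bs t. e \<in> C})) \<le> b" using i by simp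
    qed
    also have "\<dots> \<le> (2 * c + 1) * b"
      using card_routes_at_through [OF f] by (simp only: of_nat_id mult_le_mono1)
    finally have cA: "card ?A \<le> (2 * c + 1) * b" .

    let ?Q = "{i \<in> pairs. f \<in> path_edges (P i)}"
    let ?R = "{(k, e). k \<in> routes e \<and> f \<in> route_edges k e}"
    let ?\<pi> = "\<lambda>(t, e). (pred e (Some t), e)"
    let ?B' = "{i\<in>IB. ?\<pi> i \<in> ?R}"
    \<comment> \<open>\<open>f\<close> lies on the path of the index itself or on the preceding
      route. The former happens at most \<open>c\<close> times, the latter at most
      \<open>c + 1\<close> times because \<open>pred e\<close> is injective.\<close>
    have "?B \<subseteq> ?Q \<union> ?B'"
    proof
      fix i assume i: "i \<in> ?B"
      obtain t e where te: "i = (t, e)" by (cases i)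
      show "i \<in> ?Q \<union> ?B'"
        using i IB [of t e] unfolding te genB_def by (auto simp: IB_def)
    qed
    then have "card ?B \<le> card (?Q \<union> ?B')"
      using finite_pairs fin_IB by (intro card_mono) auto
    also have "\<dots> \<le> card ?Q + card ?B'" by (rule card_Un_le)
    also have "card ?B' \<le> card ?R"
    proof (rule card_inj_on_le)
      show "inj_on ?\<pi> ?B'"
      proof (rule inj_onI)
        fix i j assume ij: "i \<in> ?B'" "j \<in> ?B'" "?\<pi> i = ?\<pi> j"
        obtain t e t' where te: "i = (t, e)" "j = (t', e)" using ij(3) by (cases i; cases j) auto
        then have "Some t \<in> routes e - {a e}" "Some t' \<in> routes e - {a e}" using ij IB(1) by auto
        moreover have "pred e (Some t) = pred e (Some t')" using ij(3) te by simp
        moreover have "routes e \<noteq> {}" using calculation(1) by blast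
        ultimately have "Some t = Some t'" using inj_onD [OF pred_inj, of e "Some t" "Some t'"] by simp
        then show "i = j" using te by simp
      qed
      show "?\<pi> ` ?B' \<subseteq> ?R" by (rule image_subsetI) simp
      show "finite ?R" by (rule card_routes_through(1) [OF f])
    qed
    also have "card ?Q + card ?R \<le> c + (c + 1)"
      using path_congestion [OF f] card_routes_through(2) [OF f] by (rule add_mono)
    finally have "card ?B \<le> 2 * c + 1" by simp
    then show ?thesis using split cA by (simp add: algebra_simps)
  qed
  then show ?thesis using basis_number_le [OF simple S_sub S_span] by blast
qed

end

theorem theorem3p1:
  fixes G :: "'a graph" and T :: "'t graph" and r :: 't and \<beta> :: "'t \<Rightarrow> 'a set"
    and b c :: nat
  assumes "simple_graph G"
    and "tree_decomposition G T r \<beta>"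
    and "\<And>t. t \<in> verts T \<Longrightarrow> basis_number (torso G T r \<beta> t) \<le> b"
    and "\<exists>P. captures_adhesions G T r \<beta> P \<and>
             congestion G (adhesion_pairs T r \<beta>) (\<lambda>i. path_edges (P i)) \<le> c"
  shows "basis_number G \<le> (2 * c + 1) * (b + 1)"
proof -
  obtain P where P: "captures_adhesions G T r \<beta> P"
      "congestion G (adhesion_pairs T r \<beta>) (\<lambda>i. path_edges (P i)) \<le> c"
    using assms(4) by blast
  have "card {i \<in> adhesion_pairs T r \<beta>. f \<in> path_edges (P i)} \<le> c" if "f \<in> edges G" for f
    by (rule le_trans [OF card_le_congestion [OF finite_edges [OF assms(1)] that] P(2)])
  then interpret routed_decomposition G T r \<beta> P c
    using assms(1,2) P(1) by unfold_locales
  show ?thesis using assms(3) by (rule basis_number_le_routed)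
qed

end
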